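(* Let $\mathfrak H$, $\mathcal H$ be Krein spaces and $\mathfrak L$ a Hilbert space. Let $T$ be a closed symmetric linear relation in $\mathfrak H$, let $(\mathfrak L,\Gamma)$ be an isometric (respectively essentially unitary, respectively unitary) boundary pair for $T^+$, put $A_*:=\operatorname{dom}\Gamma$, and let $V$ be a unitary relation from the $\widehat J_{\mathfrak H}$-space $\mathfrak H^2$ to the $\widehat J_{\mathcal H}$-space $\mathcal H^2$ with closed $\operatorname{dom}V\supseteq A_*$. Put $T':=V(T)$ and $\Gamma':=\Gamma V^{-1}$. Then: $T'$ is a closed symmetric relation in $\mathcal H$, $(\mathfrak L,\Gamma')$ is an isometric (respectively essentially unitary, respectively unitary) boundary pair for the adjoint $T'^{+}=V(T^+)$, and the corresponding Weyl family $M_{\Gamma'}$ is given by $$M_{\Gamma'}(z)=\Gamma(\widehat{\mathfrak N}^V_z(A_* )),\quad z\in\mathbb C_*,\qquad\text{where}\quad \widehat{\mathfrak N}^V_z(A_* ):=\operatorname{dom}\bigl(V\cap(A_*\times zI_{\mathcal H})\bigr).$$ If moreover $\ker V\subseteq\ker\Gamma$, then $V$ establishes (via $\Gamma\mapsto\Gamma'=\Gamma V^{-1}$) a 1-1 correspondence between an isometric (respectively essentially unitary, respectively unitary) boundary pair $(\mathfrak L,\Gamma)$ for $T^+$ and an isometric (respectively essentially unitary, respectively unitary) boundary pair $(\mathfrak L,\Gamma')$ for $T'^{+}$.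
   Context: Linear relations: a relation from a linear space $X$ to a linear space $Y$ is a linear subset $R\subseteq X\times Y$ (a relation in $X$ if $X=Y$); operators are identified with their graphs. $\operatorname{dom}R,\operatorname{ran}R$ are the domain and range, $\ker R=\{x:(x,0)\in R\}$, $\operatorname{mul}R=\{y:(0,y)\in R\}$, $R^{-1}=\{(y,x):(x,y)\in R\}$, $R(S)=\{y:\exists x\in S,\ (x,y)\in R\}$, $\overline R$ is the closure; $QR=\{(x,w):\exists y,\ (x,y)\in R,(y,w)\in Q\}$ is the composition. $zI_{\mathcal H}=\{(h,zh):h\in\mathcal H\}$. $\mathbb C_*=\mathbb C\setminus\mathbb R$. Krein space: a Hilbert space $(\mathfrak H,\langle\cdot,\cdot\rangle)$ with a fundamental symmetry $J_{\mathfrak H}=J_{\mathfrak H}^*=J_{\mathfrak H}^{-1}$ and indefinite metric $[f,g]=\langle f,J_{\mathfrak H}g\rangle$. The adjoint of a relation $T$ in $\mathfrak H$ is $T^+=\{(g,g')\in\mathfrak H^2:[f',g]=[f,g']\ \forall(f,f')\in T\}$; $T$ is symmetric if $T\subseteq T^+$. $\mathfrak H^2$ carries the fundamental symmetry $\widehat J_{\mathfrak H}=\begin{pmatrix}0&-iJ_{\mathfrak H}\\ iJ_{\mathfrak H}&0\end{pmatrix}$, and similarly $\mathcal H^2$ carries $\widehat J_{\mathcal H}$; for the Hilbert space $\mathfrak L$, $\mathfrak L^2$ carries $\widehat J^\circ_{\mathfrak L}=\begin{pmatrix}0&-iI\\ iI&0\end{pmatrix}$. For a relation $R$ between two such spaces,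 from one with fundamental symmetry $j_1$ to one with fundamental symmetry $j_2$, put $R^+=j_1R^*j_2$ ($R^*$ the Hilbert space adjoint) and $R_\#=(R^+)^{-1}$. $R$ is isometric if $R\subseteq R_\#$, unitary if $R=R_\#$, essentially unitary if $\overline R=R_\#$. For a closed symmetric relation $T$ in $\mathfrak H$ and $\Gamma\subseteq\mathfrak H^2\times\mathfrak L^2$, $(\mathfrak L,\Gamma)$ is an isometric boundary pair for $T^+$ if $\Gamma$ is isometric and $T=\ker\Gamma_\#$; it is a unitary (essentially unitary) boundary pair for $T^+$ if in addition $\Gamma$ is unitary (essentially unitary). Its Weyl family is $M_\Gamma(z)=\{\widehat l\in\mathfrak L^2:\exists f,\ ((f,zf),\widehat l)\in\Gamma\}$, $z\in\mathbb C_*$. The same definitions apply with $\mathcal H$ in place of $\mathfrak H$.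
   Formalization: In the isometric and essentially unitary cases the 1-1 correspondence is onto those boundary pairs Γ' for T'^+ with mul V ⊆ ker Γ' (exactly the image of Γ ↦ ΓV^{-1}); onto all such pairs it fails, e.g. for 𝔥 = {0}. The unitary case is onto all unitary pairs. *)

theory Defs
  imports "HOL-Analysis.Analysis"
begin

section \<open>Complex Hilbert spaces\<close>

class complex_vector = real_vector +
  fixes scaleC :: "complex \<Rightarrow> 'a \<Rightarrow> 'a"  (infixr \<open>*\<^sub>C\<close> 75)
  assumes scaleC_add_right: "a *\<^sub>C (x + y) = a *\<^sub>C x + a *\<^sub>C y"
    and scaleC_add_left: "(a + b) *\<^sub>C x = a *\<^sub>C x + b *\<^sub>C x"
    and scaleC_scaleC: "a *\<^sub>C b *\<^sub>C x = (a * b) *\<^sub>C x"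
    and scaleC_one: "1 *\<^sub>C x = x"
    and scaleC_of_real: "complex_of_real r *\<^sub>C x = r *\<^sub>R x"

text \<open>The complex inner product is linear in the second argument.  Its real part is the
  library's real inner product, so that norm and topology are those of \<^class>\<open>real_inner\<close>;
  positive definiteness is inherited from there.\<close>

class complex_inner = complex_vector + real_inner +
  fixes cinner :: "'a \<Rightarrow> 'a \<Rightarrow> complex"
  assumes cinner_commute: "cinner x y = cnj (cinner y x)"
    and cinner_add_right: "cinner x (y + z) = cinner x y + cinner x z"
    and cinner_scaleC_right: "cinner x (a *\<^sub>C y) = a * cinner x y"
    and Re_cinner: "Re (cinner x y) = inner x y"

class chilbert_space = complex_inner + complete_space

global_interpretation complex_vector: vector_space "scaleC :: complex \<Rightarrow> 'a \<Rightarrow> 'a::complex_vector"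
  by unfold_locales (auto simp: scaleC_add_right scaleC_add_left scaleC_scaleC scaleC_one)

instantiation complex :: chilbert_space
begin

definition scaleC_complex :: "complex \<Rightarrow> complex \<Rightarrow> complex"
  where "scaleC_complex a x = a * x"

definition cinner_complex :: "complex \<Rightarrow> complex \<Rightarrow> complex"
  where "cinner_complex x y = cnj x * y"

instance
  by standard
    (auto simp: scaleC_complex_def cinner_complex_def inner_complex_def algebra_simps scaleR_conv_of_real)

end

instantiation prod :: (complex_vector, complex_vector) complex_vector
begin

definition scaleC_prod :: "complex \<Rightarrow> 'a \<times> 'b \<Rightarrow> 'a \<times> 'b"
  where "scaleC_prod a p = (a *\<^sub>C fst p, a *\<^sub>C snd p)"

instance
  by standard
    (auto simp: scaleC_prod_def scaleC_add_right scaleC_add_left scaleC_scaleC scaleC_one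
      scaleC_of_real prod_eq_iff)

end

instantiation prod :: (complex_inner, complex_inner) complex_inner
begin

definition cinner_prod :: "'a \<times> 'b \<Rightarrow> 'a \<times> 'b \<Rightarrow> complex"
  where "cinner_prod p q = cinner (fst p) (fst q) + cinner (snd p) (snd q)"

instance
proof
  fix x y z :: "'a \<times> 'b" and a :: complex
  show "cinner x y = cnj (cinner y x)"
    using cinner_commute[of "fst x" "fst y"] cinner_commute[of "snd x" "snd y"]
    by (simp add: cinner_prod_def)
  show "cinner x (y + z) = cinner x y + cinner x z"
    by (simp add: cinner_prod_def cinner_add_right)
  show "cinner x (a *\<^sub>C y) = a * cinner x y"
    by (simp add: cinner_prod_def scaleC_prod_def cinner_scaleC_right distrib_left)
  show "Re (cinner x y) = inner x y"
    by (simp add: cinner_prod_def inner_prod_def Re_cinner)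
qed

end

instance prod :: (chilbert_space, chilbert_space) chilbert_space ..


section \<open>Linear relations\<close>

text \<open>A relation from \<open>'a\<close> to \<open>'b\<close> is a set of pairs.  Domain, range, inverse and image are
  \<^const>\<open>Domain\<close>, \<^const>\<open>Range\<close>, \<^const>\<open>converse\<close> and \<^const>\<open>Image\<close>.  The composition written
  \<open>Q R\<close> (first \<open>R\<close>, then \<open>Q\<close>) in operator notation is \<open>R O Q\<close>.\<close>

abbreviation linear_relation :: "('a::complex_vector \<times> 'b::complex_vector) set \<Rightarrow> bool"
  where "linear_relation R \<equiv> complex_vector.subspace R"

definition op_graph :: "('a \<Rightarrow> 'b) \<Rightarrow> ('a \<times> 'b) set"
  where "op_graph f = {(x, f x) | x. True}"

definition rel_ker :: "('a \<times> 'b::zero) set \<Rightarrow> 'a set"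
  where "rel_ker R = {x. (x, 0) \<in> R}"

definition rel_mul :: "('a::zero \<times> 'b) set \<Rightarrow> 'b set"
  where "rel_mul R = {y. (0, y) \<in> R}"

definition hilbert_adj :: "('a::complex_inner \<times> 'b::complex_inner) set \<Rightarrow> ('b \<times> 'a) set"
  where "hilbert_adj R = {(y, x). \<forall>(u, v) \<in> R. cinner v y = cinner u x}"


section \<open>Krein spaces\<close>

text \<open>A Krein space is a Hilbert space together with a fundamental symmetry
  \<open>J = J\<^sup>* = J\<^sup>-\<^sup>1\<close>; it is represented by the type and the operator \<open>J\<close>.  Boundedness of
  \<open>J\<close> follows from self-adjointness, as \<open>J\<close> is everywhere defined.\<close>

definition fundamental_symmetry :: "('a::chilbert_space \<Rightarrow> 'a) \<Rightarrow> bool"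
  where "fundamental_symmetry J \<longleftrightarrow>
    linear_relation (op_graph J) \<and>
    op_graph J = hilbert_adj (op_graph J) \<and> op_graph J = (op_graph J)\<inverse>"

definition krein_inner :: "('a::chilbert_space \<Rightarrow> 'a) \<Rightarrow> 'a \<Rightarrow> 'a \<Rightarrow> complex"
  where "krein_inner J f g = cinner f (J g)"

definition krein_adj :: "('a::chilbert_space \<Rightarrow> 'a) \<Rightarrow> ('a \<times> 'a) set \<Rightarrow> ('a \<times> 'a) set"
  where "krein_adj J T = {(g, g'). \<forall>(f, f') \<in> T. krein_inner J f' g = krein_inner J f g'}"

definition symmetric_relation :: "('a::chilbert_space \<Rightarrow> 'a) \<Rightarrow> ('a \<times> 'a) set \<Rightarrow> bool"
  where "symmetric_relation J T \<longleftrightarrow> linear_relation T \<and> T \<subseteq> krein_adj J T"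

text \<open>The fundamental symmetry of the doubled space.  A Hilbert space is the case
  \<^term>\<open>J = id\<close>.\<close>

definition J_hat :: "('a::chilbert_space \<Rightarrow> 'a) \<Rightarrow> 'a \<times> 'a \<Rightarrow> 'a \<times> 'a"
  where "J_hat J = (\<lambda>(f, f'). ((- \<i>) *\<^sub>C J f', \<i> *\<^sub>C J f))"


section \<open>Isometric and unitary relations\<close>

text \<open>\<^term>\<open>rel_adj j1 j2 R\<close> is \<open>R\<^sup>+ = j1 R\<^sup>* j2\<close>, the composition being taken in operator
  notation.\<close>

definition rel_adj ::
    "('a::chilbert_space \<Rightarrow> 'a) \<Rightarrow> ('b::chilbert_space \<Rightarrow> 'b) \<Rightarrow> ('a \<times> 'b) set \<Rightarrow> ('b \<times> 'a) set"
  where "rel_adj j1 j2 R = op_graph j2 O hilbert_adj R O op_graph j1"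

definition rel_sharp ::
    "('a::chilbert_space \<Rightarrow> 'a) \<Rightarrow> ('b::chilbert_space \<Rightarrow> 'b) \<Rightarrow> ('a \<times> 'b) set \<Rightarrow> ('a \<times> 'b) set"
  where "rel_sharp j1 j2 R = (rel_adj j1 j2 R)\<inverse>"

definition isometric_relation ::
    "('a::chilbert_space \<Rightarrow> 'a) \<Rightarrow> ('b::chilbert_space \<Rightarrow> 'b) \<Rightarrow> ('a \<times> 'b) set \<Rightarrow> bool"
  where "isometric_relation j1 j2 R \<longleftrightarrow> linear_relation R \<and> R \<subseteq> rel_sharp j1 j2 R"

definition unitary_relation ::
    "('a::chilbert_space \<Rightarrow> 'a) \<Rightarrow> ('b::chilbert_space \<Rightarrow> 'b) \<Rightarrow> ('a \<times> 'b) set \<Rightarrow> bool"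
  where "unitary_relation j1 j2 R \<longleftrightarrow> linear_relation R \<and> R = rel_sharp j1 j2 R"

definition ess_unitary_relation ::
    "('a::chilbert_space \<Rightarrow> 'a) \<Rightarrow> ('b::chilbert_space \<Rightarrow> 'b) \<Rightarrow> ('a \<times> 'b) set \<Rightarrow> bool"
  where "ess_unitary_relation j1 j2 R \<longleftrightarrow> linear_relation R \<and> closure R = rel_sharp j1 j2 R"


section \<open>Boundary pairs\<close>

text \<open>The following predicates say that \<open>(\<LL>, \<Gamma>)\<close> is a boundary pair for the adjoint \<open>T\<^sup>+\<close> of
  the relation \<open>T\<close> in the Krein space with fundamental symmetry \<open>J\<close>; the Hilbert space \<open>\<LL>\<close> is
  the type \<open>'l\<close>.  They are meant for closed symmetric \<open>T\<close>.\<close>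

definition isometric_bp ::
    "('h::chilbert_space \<Rightarrow> 'h) \<Rightarrow> ('h \<times> 'h) set \<Rightarrow> (('h \<times> 'h) \<times> ('l::chilbert_space \<times> 'l)) set \<Rightarrow> bool"
  where "isometric_bp J T \<Gamma> \<longleftrightarrow>
    isometric_relation (J_hat J) (J_hat id) \<Gamma> \<and> T = rel_ker (rel_sharp (J_hat J) (J_hat id) \<Gamma>)"

definition ess_unitary_bp ::
    "('h::chilbert_space \<Rightarrow> 'h) \<Rightarrow> ('h \<times> 'h) set \<Rightarrow> (('h \<times> 'h) \<times> ('l::chilbert_space \<times> 'l)) set \<Rightarrow> bool"
  where "ess_unitary_bp J T \<Gamma> \<longleftrightarrow>
    isometric_bp J T \<Gamma> \<and> ess_unitary_relation (J_hat J) (J_hat id) \<Gamma>"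

definition unitary_bp ::
    "('h::chilbert_space \<Rightarrow> 'h) \<Rightarrow> ('h \<times> 'h) set \<Rightarrow> (('h \<times> 'h) \<times> ('l::chilbert_space \<times> 'l)) set \<Rightarrow> bool"
  where "unitary_bp J T \<Gamma> \<longleftrightarrow>
    isometric_bp J T \<Gamma> \<and> unitary_relation (J_hat J) (J_hat id) \<Gamma>"

definition weyl_family ::
    "(('h::chilbert_space \<times> 'h) \<times> ('l::chilbert_space \<times> 'l)) set \<Rightarrow> complex \<Rightarrow> ('l \<times> 'l) set"
  where "weyl_family \<Gamma> z = {l. \<exists>f. ((f, z *\<^sub>C f), l) \<in> \<Gamma>}"

definition N_hat ::
    "(('h::chilbert_space \<times> 'h) \<times> ('k::chilbert_space \<times> 'k)) set \<Rightarrow> complex \<Rightarrow> ('h \<times> 'h) set \<Rightarrow> ('h \<times> 'h) set"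
  where "N_hat V z A = Domain (V \<inter> (A \<times> op_graph (\<lambda>h. z *\<^sub>C h)))"

end

theory Submission
  imports Defs
begin

text \<open>Write \<open>S\<^sup>\<bottom>\<close> for the orthogonal complement with respect to the indefinite metric.  Then
  \<open>T\<^sup>+ = T\<^sup>\<bottom>\<close> in the doubled space, \<open>ker R\<^sub># = (dom R)\<^sup>\<bottom>\<close>, and \<open>R\<^sub>#\<close> is itself an orthogonal
  complement of \<open>R\<close> in the product space, so \<open>R\<^sub>#\<^sub># = closure R\<close> for linear \<open>R\<close>.
  As \<open>dom V\<close> is closed, so is \<open>ran V = (mul V)\<^sup>\<bottom>\<close>; therefore a vector orthogonal to \<open>mul V\<close> lifts
  along \<open>V\<close>, which gives \<open>V(S)\<^sup>\<bottom> = V(S\<^sup>\<bottom>)\<close> and \<open>(\<Gamma> V\<^sup>-\<^sup>1)\<^sub># = \<Gamma>\<^sub># V\<^sup>-\<^sup>1\<close> when \<open>S\<close> and \<open>dom \<Gamma>\<close> lie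
  in \<open>dom V\<close>.  All transfer statements follow from these two identities, and the inverse
  correspondence is obtained by exchanging \<open>V\<close> and \<open>V\<^sup>-\<^sup>1\<close>.\<close>

section \<open>Complex Hilbert spaces\<close>

subclass (in chilbert_space) banach ..

lemma cinner_add_left: "cinner (x + y) z = cinner x z + cinner y z"
  by (metis cinner_add_right cinner_commute complex_cnj_add)

lemma cinner_scaleC_left: "cinner (a *\<^sub>C x) y = cnj a * cinner x y"
  by (metis cinner_commute cinner_scaleC_right complex_cnj_mult)

lemma cinner_zero_right [simp]: "cinner x 0 = 0"
  using cinner_add_right[of x 0 0] by simp

lemma cinner_zero_left [simp]: "cinner 0 x = 0"
  using cinner_add_left[of 0 0 x] by simp

lemma scaleC_minus_one: "(- 1) *\<^sub>C x = - (x::'a::complex_vector)"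
  using scaleC_of_real[of "-1" x] by simp

lemma cinner_minus_right [simp]: "cinner x (- y) = - cinner x y"
  by (metis cinner_scaleC_right scaleC_minus_one mult_minus1)

lemma cinner_minus_left [simp]: "cinner (- x) y = - cinner x y"
  using cinner_scaleC_left[of "- 1" x y] by (simp add: scaleC_minus_one)

lemma cinner_diff_right: "cinner x (y - z) = cinner x y - cinner x z"
  using cinner_add_right[of x y "- z"] by simp

section \<open>Real and complex orthogonality, projection, uniform boundedness\<close>

lemma csubspace_imp_subspace:
  assumes "complex_vector.subspace S"
  shows "subspace S"
  using assms unfolding complex_vector.subspace_def subspace_def
  by (metis scaleC_of_real)

lemma subspace_closure:
  fixes S :: "'a::real_normed_vector set"
  assumes "subspace S"
  shows "subspace (closure S)"
  unfolding subspace_def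
proof (intro conjI ballI allI)
  show "0 \<in> closure S"
    using subspace_0[OF assms] closure_subset by blast
next
  fix x y assume "x \<in> closure S" "y \<in> closure S"
  then obtain f g where "\<forall>n. f n \<in> S" "f \<longlonglongrightarrow> x" "\<forall>n. g n \<in> S" "g \<longlonglongrightarrow> y"
    by (auto simp: closure_sequential)
  then show "x + y \<in> closure S"
    unfolding closure_sequential
    by (intro exI[of _ "\<lambda>n. f n + g n"]) (simp add: subspace_add[OF assms] tendsto_add)
next
  fix c x assume "x \<in> closure S"
  then obtain f where "\<forall>n. f n \<in> S" "f \<longlonglongrightarrow> x"
    by (auto simp: closure_sequential)
  then show "c *\<^sub>R x \<in> closure S"
    unfolding closure_sequential
    by (intro exI[of _ "\<lambda>n. c *\<^sub>R f n"]) (simp add: subspace_scale[OF assms] tendsto_scaleR)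
qed

text \<open>With \<open>s\<close> the subspace contains \<open>\<i> *\<^sub>C s\<close>, whose real
  pairing with \<open>w\<close> is the imaginary part of \<open>cinner s w\<close>. Real projections
  thereby become complex ones.\<close>

lemma cinner_eq_0_if_inner_eq_0:
  assumes "complex_vector.subspace S" and "\<And>s. s \<in> S \<Longrightarrow> inner s w = 0" and "s \<in> S"
  shows "cinner s w = 0"
proof -
  have "\<i> *\<^sub>C s \<in> S"
    using assms by (simp add: complex_vector.subspace_scale)
  then have "Re (cinner (\<i> *\<^sub>C s) w) = 0" "Re (cinner s w) = 0"
    using assms by (simp_all add: Re_cinner)
  then show ?thesis
    by (simp add: cinner_scaleC_left complex_eq_iff)
qed

text \<open>A minimising sequence for the distance from \<open>x\<close> is Cauchy, and its limit
  \<open>p\<close> is optimal against perturbations in every direction \<open>t\<close> of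
  \<open>S\<close>.\<close>

lemma orthogonal_projection_exists:
  fixes S :: "'a::{real_inner,complete_space} set"
  assumes S: "subspace S" "closed S"
  shows "\<exists>p\<in>S. \<forall>s\<in>S. inner s (x - p) = 0"
proof -
  define d where "d = (INF s\<in>S. (norm (x - s))\<^sup>2)"
  have S0: "0 \<in> S"
    using S by (simp add: subspace_0)
  have bdd: "bdd_below ((\<lambda>s. (norm (x - s))\<^sup>2) ` S)"
    by (rule bdd_belowI2[of _ 0]) simp
  have d_le: "d \<le> (norm (x - s))\<^sup>2" if "s \<in> S" for s
    unfolding d_def using bdd that by (rule cINF_lower)
  have "\<exists>s\<in>S. (norm (x - s))\<^sup>2 < d + 1 / real (Suc n)" for n
  proof -
    have "d < d + 1 / real (Suc n)" by simp
    then show ?thesis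
      unfolding d_def using S0 bdd by (subst (asm) cINF_less_iff) auto
  qed
  then obtain s where sS: "\<And>n. s n \<in> S"
    and s_lt: "\<And>n. (norm (x - s n))\<^sup>2 < d + 1 / real (Suc n)"
    by metis
  \<comment> \<open>The midpoint lies in \<open>S\<close>, so its squared distance is at least
    \<open>d\<close>. The parallelogram law then leaves only the excess of the two terms over
    \<open>d\<close>.\<close>
  have para: "(norm (s m - s n))\<^sup>2 \<le> 4 / real (Suc N)" if "N \<le> m" "N \<le> n" for m n N
  proof -
    have "(1/2) *\<^sub>R (s m + s n) \<in> S"
      using S sS by (simp add: subspace_add subspace_scale)
    then have "d \<le> (norm (x - (1/2) *\<^sub>R (s m + s n)))\<^sup>2" by (rule d_le)
    moreover have "(norm (s m - s n))\<^sup>2 + 4 * (norm (x - (1/2) *\<^sub>R (s m + s n)))\<^sup>2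
        = 2 * (norm (x - s m))\<^sup>2 + 2 * (norm (x - s n))\<^sup>2"
      by (simp add: power2_norm_eq_inner inner_diff_left inner_diff_right inner_add_left
          inner_add_right inner_commute algebra_simps)
    moreover have "1 / real (Suc m) \<le> 1 / real (Suc N)" "1 / real (Suc n) \<le> 1 / real (Suc N)"
      using that by (simp_all add: frac_le)
    ultimately show ?thesis
      using s_lt[of m] s_lt[of n] by linarith
  qed
  have "Cauchy s"
  proof (rule metric_CauchyI)
    fix e :: real assume "e > 0"
    then obtain N where N: "4 / e\<^sup>2 < real (Suc N)"
      using reals_Archimedean2[of "4 / e\<^sup>2"] less_trans[of _ _ "real (Suc _)"]
      by (metis lessI of_nat_less_iff)
    then have "4 / real (Suc N) < e\<^sup>2"
      using \<open>e > 0\<close> by (simp add: field_simps)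
    then have "norm (s m - s n) < e" if "m \<ge> N" "n \<ge> N" for m n
      using para[OF that] \<open>e > 0\<close> by (meson le_less_trans less_imp_le power_less_imp_less_base)
    then show "\<exists>N. \<forall>m\<ge>N. \<forall>n\<ge>N. dist (s m) (s n) < e"
      unfolding dist_norm by blast
  qed
  then obtain p where p: "s \<longlonglongrightarrow> p"
    using Cauchy_convergent convergent_def by blast
  then have pS: "p \<in> S"
    using S(2) sS closed_sequentially by blast
  have "(\<lambda>n. (norm (x - s n))\<^sup>2) \<longlonglongrightarrow> (norm (x - p))\<^sup>2"
    using p by (intro tendsto_intros)
  moreover have "(\<lambda>n. d + 1 / real (Suc n)) \<longlonglongrightarrow> d + 0"
    using LIMSEQ_inverse_real_of_nat by (intro tendsto_intros) (simp add: inverse_eq_divide)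
  ultimately have p_le: "(norm (x - p))\<^sup>2 \<le> d"
    using s_lt by (intro LIMSEQ_le) (auto intro: less_imp_le)
  have "inner t (x - p) = 0" if "t \<in> S" for t
  proof (cases "t = 0")
    case False
    \<comment> \<open>This \<open>a\<close> minimises the quadratic polynomial
      \<open>(norm (x - (p + a *\<^sub>R t)))\<^sup>2\<close>.\<close>
    define a where "a = inner t (x - p) / inner t t"
    have "p + a *\<^sub>R t \<in> S"
      using S pS that by (simp add: subspace_add subspace_scale)
    then have "(norm (x - p))\<^sup>2 \<le> (norm (x - (p + a *\<^sub>R t)))\<^sup>2"
      using d_le p_le order_trans by blast
    also have "\<dots> = (norm (x - p))\<^sup>2 - 2 * a * inner t (x - p) + a * a * inner t t"
      by (simp add: power2_norm_eq_inner inner_diff_left inner_diff_right inner_add_left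
          inner_add_right inner_commute algebra_simps)
    also have "\<dots> = (norm (x - p))\<^sup>2 - (inner t (x - p))\<^sup>2 / inner t t"
      using False by (simp add: a_def field_simps power2_eq_square)
    finally have "(inner t (x - p))\<^sup>2 / inner t t \<le> 0" by simp
    moreover have "inner t t > 0" using False by simp
    ultimately show ?thesis
      by (simp add: divide_le_0_iff)
  qed simp
  with pS show ?thesis by blast
qed

text \<open>Sokal's gliding-hump argument: from an unbounded sequence \<open>x\<^sub>n\<close> of \<open>B\<close> one builds
  \<open>u = \<Sum>\<^sub>n \<plusminus> 3\<^sup>-\<^sup>n x\<^sub>n / \<parallel>x\<^sub>n\<parallel>\<close>, the sign being chosen so that the partial sum up to \<open>n\<close> still
  sees \<open>x\<^sub>n\<close>; the tail is too small to cancel this.\<close>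

lemma pointwise_bounded_imp_bounded:
  fixes M :: "'a::{real_inner,banach} set"
  assumes M: "subspace M" "closed M" and "B \<subseteq> M"
    and ptw: "\<And>u. u \<in> M \<Longrightarrow> \<exists>K. \<forall>x\<in>B. \<bar>inner u x\<bar> \<le> K"
  shows "bounded B"
proof (rule ccontr)
  assume "\<not> bounded B"
  then have "\<exists>x\<in>B. norm x > 4 ^ n" for n :: nat
    unfolding bounded_iff by (meson not_le)
  then obtain x where xB: "\<And>n::nat. x n \<in> B" and x_gt: "\<And>n. norm (x n) > 4 ^ n"
    by metis
  define h where "h n = (1 / 3 ^ n) *\<^sub>R sgn (x n)" for n
  define u where "u = rec_nat 0 (\<lambda>n v. if inner v (x n) \<ge> 0 then v + h n else v - h n)"
  have u_0: "u 0 = 0"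
    and u_Suc: "u (Suc n) = (if inner (u n) (x n) \<ge> 0 then u n + h n else u n - h n)" for n
    by (simp_all add: u_def)
  have x_pos: "norm (x n) > 0" for n
    using x_gt[of n] by (meson less_trans zero_less_numeral zero_less_power)
  have norm_h: "norm (h n) = 1 / 3 ^ n" for n
    using x_pos[of n] by (simp add: h_def norm_sgn)
  have hM: "h n \<in> M" for n
    using xB \<open>B \<subseteq> M\<close> M(1) by (auto simp: h_def sgn_div_norm intro!: subspace_scale)
  have uM: "u n \<in> M" for n
    by (induction n) (use M(1) hM in \<open>auto simp: u_0 u_Suc subspace_0 subspace_add subspace_diff\<close>)
  have inner_h: "inner (h n) (x n) = norm (x n) / 3 ^ n" for n
    using x_pos[of n] by (simp add: h_def sgn_div_norm dot_square_norm power2_eq_square)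
  have hump: "norm (x n) / 3 ^ n \<le> \<bar>inner (u (Suc n)) (x n)\<bar>" for n
    using inner_h[of n] x_pos[of n]
    by (auto simp: u_Suc inner_add_left inner_diff_left)
  have step: "norm (u (Suc n) - u n) = 1 / 3 ^ n" for n
    by (simp add: u_Suc norm_h)
  \<comment> \<open>The bound is the exact geometric sum of the \<open>k\<close> steps from index
    \<open>n\<close>; keeping the factor \<open>1 - 1 / 3 ^ k\<close> lets the induction
    close.\<close>
  have tail: "norm (u (n + k) - u n) \<le> (3 / 2) * (1 / 3 ^ n) * (1 - 1 / 3 ^ k)" for n k
  proof (induction k)
    case (Suc k)
    have "norm (u (n + Suc k) - u n) \<le> norm (u (Suc (n + k)) - u (n + k)) + norm (u (n + k) - u n)"
      using norm_triangle_ineq[of "u (Suc (n + k)) - u (n + k)" "u (n + k) - u n"] by simp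
    also have "\<dots> \<le> 1 / 3 ^ (n + k) + (3 / 2) * (1 / 3 ^ n) * (1 - 1 / 3 ^ k)"
      using Suc step[of "n + k"] by simp
    also have "\<dots> = (3 / 2) * (1 / 3 ^ n) * (1 - 1 / 3 ^ Suc k)"
      by (simp add: field_simps power_add)
    finally show ?case .
  qed simp
  have tail': "norm (u (n + k) - u n) \<le> (3 / 2) * (1 / 3 ^ n)" for n k
  proof -
    have "(3 / 2) * (1 / 3 ^ n) * (1 - 1 / 3 ^ k) \<le> (3 / 2) * (1 / 3 ^ n) * (1::real)"
      by (intro mult_left_mono) auto
    then show ?thesis using tail[of n k] by linarith
  qed
  have "summable (\<lambda>n. u (Suc n) - u n)"
  proof (rule summable_norm_cancel)
    show "summable (\<lambda>n. norm (u (Suc n) - u n))"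
      using summable_geometric[of "1/3 :: real"] by (simp add: step power_one_over)
  qed
  then obtain w where w: "u \<longlonglongrightarrow> w"
    using summable_LIMSEQ by (fastforce simp: sum_lessThan_telescope u_0)
  have wM: "w \<in> M"
    using M(2) uM w closed_sequentially by blast
  have w_tail: "norm (w - u n) \<le> (3 / 2) * (1 / 3 ^ n)" for n
  proof (rule Lim_norm_ubound[of sequentially "\<lambda>k. u (n + k) - u n"])
    show "(\<lambda>k. u (n + k) - u n) \<longlonglongrightarrow> w - u n"
      using LIMSEQ_ignore_initial_segment[OF w, of n]
      by (intro tendsto_intros) (simp add: add.commute)
  qed (use tail' in auto)
  \<comment> \<open>The tail after index \<open>Suc n\<close> costs at most half of the hump, and
    \<open>4 ^ n\<close> outgrows \<open>3 ^ n\<close>, so the remaining half is unbounded.\<close>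
  have big: "(4 / 3) ^ n / 2 \<le> \<bar>inner w (x n)\<bar>" for n
  proof -
    have "\<bar>inner (w - u (Suc n)) (x n)\<bar> \<le> norm (w - u (Suc n)) * norm (x n)"
      by (rule Cauchy_Schwarz_ineq2)
    also have "\<dots> \<le> (3 / 2) * (1 / 3 ^ Suc n) * norm (x n)"
      by (intro mult_right_mono w_tail) simp
    also have "\<dots> = norm (x n) / 3 ^ n / 2" by simp
    finally have "norm (x n) / 3 ^ n / 2 \<le> \<bar>inner w (x n)\<bar>"
      using hump[of n] by (simp add: inner_diff_left)
    moreover have "(4 / 3) ^ n / 2 \<le> norm (x n) / 3 ^ n / 2"
      using x_gt[of n] by (simp add: power_divide divide_right_mono)
    ultimately show ?thesis by (rule order_trans[rotated])
  qed
  obtain K where K: "\<And>n. \<bar>inner w (x n)\<bar> \<le> K"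
    using ptw[OF wM] xB by blast
  obtain n where "2 * K < (4 / 3) ^ n"
    using real_arch_pow[of "4 / 3" "2 * K"] by auto
  with big[of n] K[of n] show False by linarith
qed

section \<open>Fundamental symmetries\<close>

lemma fundamental_symmetryD:
  assumes "fundamental_symmetry j"
  shows fs_add: "j (x + y) = j x + j y"
    and fs_scaleC: "j (a *\<^sub>C x) = a *\<^sub>C j x"
    and fs_invol: "j (j x) = x"
    and fs_cinner: "cinner (j x) y = cinner x (j y)"
proof -
  have sub: "linear_relation (op_graph j)" and adj: "op_graph j = hilbert_adj (op_graph j)"
    and inv: "op_graph j = (op_graph j)\<inverse>"
    using assms unfolding fundamental_symmetry_def by blast+
  have mem: "(x, y) \<in> op_graph j \<longleftrightarrow> y = j x" for x y
    by (auto simp: op_graph_def)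
  show "j (x + y) = j x + j y"
    using complex_vector.subspace_add[OF sub, of "(x, j x)" "(y, j y)"] by (simp add: mem)
  show "j (a *\<^sub>C x) = a *\<^sub>C j x"
    using complex_vector.subspace_scale[OF sub, of "(x, j x)" a]
    by (simp add: mem scaleC_prod_def)
  have "(j x, x) \<in> op_graph j"
    using inv mem by (metis converse_iff)
  then show "j (j x) = x"
    by (simp add: mem)
  have "(y, j y) \<in> hilbert_adj (op_graph j)"
    using adj mem by metis
  then show "cinner (j x) y = cinner x (j y)"
    using mem by (auto simp: hilbert_adj_def)
qed

lemma fs_zero: "fundamental_symmetry j \<Longrightarrow> j 0 = 0"
  using fs_add[of j 0 0] by simp

lemma fs_diff: "fundamental_symmetry j \<Longrightarrow> j (x - y) = j x - j y"
  using fs_add[of j "x - y" y] by (simp add: algebra_simps)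

lemma fs_minus: "fundamental_symmetry j \<Longrightarrow> j (- x) = - j x"
  using fs_scaleC[of j "- 1" x] by (simp add: scaleC_minus_one)

text \<open>An everywhere defined symmetric operator equals its adjoint: the adjoint value differs
  from \<open>j y\<close> by a vector orthogonal to the whole space.\<close>

lemma fundamental_symmetryI:
  assumes "\<And>x y. j (x + y) = j x + j y" and "\<And>a x. j (a *\<^sub>C x) = a *\<^sub>C j x"
    and "\<And>x. j (j x) = x" and "\<And>x y. cinner (j x) y = cinner x (j y)"
  shows "fundamental_symmetry j"
proof -
  have mem: "(x, y) \<in> op_graph j \<longleftrightarrow> y = j x" for x y
    by (auto simp: op_graph_def)
  have "j 0 = 0"
    using assms(1)[of 0 0] by simp
  then have "linear_relation (op_graph j)"
    unfolding complex_vector.subspace_def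
    by (auto simp: mem assms scaleC_prod_def zero_prod_def)
  moreover have "(y, x) \<in> hilbert_adj (op_graph j) \<longleftrightarrow> x = j y" for x y
  proof
    assume yx: "(y, x) \<in> hilbert_adj (op_graph j)"
    have "cinner u (x - j y) = 0" for u
    proof -
      have "(u, j u) \<in> op_graph j"
        by (simp add: mem)
      with yx have "cinner (j u) y = cinner u x"
        unfolding hilbert_adj_def by fastforce
      then show ?thesis
        by (simp add: assms(4) cinner_diff_right)
    qed
    then have "inner (x - j y) (x - j y) = 0"
      by (metis Re_cinner zero_complex.sel(1))
    then show "x = j y" by simp
  qed (auto simp: hilbert_adj_def mem assms)
  then have "op_graph j = hilbert_adj (op_graph j)"
    using mem by auto
  moreover have "op_graph j = (op_graph j)\<inverse>"
    using mem assms(3) by auto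
  ultimately show ?thesis
    unfolding fundamental_symmetry_def by blast
qed

lemma fundamental_symmetry_id: "fundamental_symmetry id"
  by (rule fundamental_symmetryI) auto

lemma fundamental_symmetry_J_hat:
  assumes "fundamental_symmetry J"
  shows "fundamental_symmetry (J_hat J)"
  by (rule fundamental_symmetryI)
    (auto simp: J_hat_def split_beta fundamental_symmetryD[OF assms] fs_minus[OF assms] scaleC_prod_def
      scaleC_add_right scaleC_scaleC scaleC_one scaleC_minus_one cinner_prod_def
      cinner_scaleC_left cinner_scaleC_right mult.commute)

lemma fs_norm:
  assumes "fundamental_symmetry j"
  shows "norm (j x) = norm x"
proof -
  have "inner (j x) (j x) = inner x x"
    using fs_cinner[OF assms, of x "j x"] fs_invol[OF assms]
    by (simp flip: Re_cinner)
  then show ?thesis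
    by (simp add: norm_eq_sqrt_inner)
qed

lemma continuous_on_fs:
  assumes "fundamental_symmetry j"
  shows "continuous_on S j"
  unfolding continuous_on_iff
  by (metis assms dist_norm fs_diff fs_norm)

section \<open>Orthogonality in the indefinite metric\<close>

text \<open>The symmetry \<open>j\<close> is arbitrary, so that one theory serves both the doubled
  spaces and the product carrying a relation.\<close>

definition krein_orth :: "('a::chilbert_space \<Rightarrow> 'a) \<Rightarrow> 'a set \<Rightarrow> 'a set"
  where "krein_orth j S = {g. \<forall>f\<in>S. cinner f (j g) = 0}"

lemma krein_inner_sym_0:
  assumes "fundamental_symmetry j"
  shows "cinner x (j y) = 0 \<longleftrightarrow> cinner y (j x) = 0"
  by (metis assms cinner_commute complex_cnj_zero fs_cinner)

lemma krein_orth_antimono: "S \<subseteq> S' \<Longrightarrow> krein_orth j S' \<subseteq> krein_orth j S"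
  by (auto simp: krein_orth_def)

lemma krein_orth_subspace:
  assumes "fundamental_symmetry j"
  shows "complex_vector.subspace (krein_orth j S)"
  unfolding complex_vector.subspace_def krein_orth_def
  by (auto simp: fs_zero[OF assms] fundamental_symmetryD[OF assms] cinner_add_right
      cinner_scaleC_right)

text \<open>Real and imaginary part are the real inner products with \<open>f\<close> and
  \<open>\<i> *\<^sub>C f\<close>.\<close>

lemma continuous_on_cinner_right: "continuous_on S (\<lambda>x. cinner f x)"
proof -
  have "cinner f x = Complex (inner f x) (- inner f (\<i> *\<^sub>C x))" for x
    by (simp add: complex_eq_iff cinner_scaleC_right flip: Re_cinner)
  moreover have "- inner f (\<i> *\<^sub>C x) = inner (\<i> *\<^sub>C f) x" for x
    by (simp add: cinner_scaleC_left cinner_scaleC_right flip: Re_cinner)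
  ultimately have "cinner f = (\<lambda>x. Complex (inner f x) (inner (\<i> *\<^sub>C f) x))"
    by auto
  then show ?thesis
    by (simp add: continuous_on_Complex continuous_on_inner)
qed

lemma closed_krein_orth:
  assumes "fundamental_symmetry j"
  shows "closed (krein_orth j S)"
proof -
  have "krein_orth j S = (\<Inter>f\<in>S. {g. cinner f (j g) = 0})"
    by (auto simp: krein_orth_def)
  moreover have "closed {g. cinner f (j g) = 0}" for f
    by (intro closed_Collect_eq continuous_on_const
        continuous_on_compose2[OF continuous_on_cinner_right continuous_on_fs[OF assms]]) auto
  ultimately show ?thesis by auto
qed

text \<open>If \<open>p\<close> is the projection of \<open>x\<close> to \<open>closure S\<close>,
  then \<open>j (x - p)\<close> lies in the complement of \<open>S\<close>. Pairing it with
  \<open>x\<close> shows \<open>x - p\<close> orthogonal to \<open>x\<close>; it is also orthogonal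
  to \<open>p\<close>, hence zero.\<close>

lemma krein_orth_orth_eq_closure:
  assumes j: "fundamental_symmetry j" and S: "complex_vector.subspace S"
  shows "krein_orth j (krein_orth j S) = closure S"
proof
  have "S \<subseteq> krein_orth j (krein_orth j S)"
    using krein_inner_sym_0[OF j] by (auto simp: krein_orth_def)
  then show "closure S \<subseteq> krein_orth j (krein_orth j S)"
    by (simp add: closure_minimal closed_krein_orth[OF j])
  show "krein_orth j (krein_orth j S) \<subseteq> closure S"
  proof
    fix x assume x: "x \<in> krein_orth j (krein_orth j S)"
    obtain p where p: "p \<in> closure S" "\<And>s. s \<in> closure S \<Longrightarrow> inner s (x - p) = 0"
      using orthogonal_projection_exists[of "closure S" x] csubspace_imp_subspace[OF S]
      by (auto intro: subspace_closure)
    have "cinner s (x - p) = 0" if "s \<in> S" for s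
      using cinner_eq_0_if_inner_eq_0[OF S p(2) that] closure_subset by blast
    then have "j (x - p) \<in> krein_orth j S"
      by (simp add: krein_orth_def fs_invol[OF j])
    then have "cinner (j (x - p)) (j x) = 0"
      using x by (simp add: krein_orth_def)
    then have "inner (x - p) x = 0"
      by (simp add: fs_cinner[OF j] fs_invol[OF j] flip: Re_cinner)
    moreover have "inner (x - p) p = 0"
      using p(2)[OF p(1)] by (simp add: inner_commute)
    ultimately have "inner (x - p) (x - p) = 0"
      by (simp add: inner_diff_right)
    then show "x \<in> closure S"
      using p(1) by simp
  qed
qed

text \<open>The form of \<open>J_hat J\<close> is \<open>\<i>\<close> times the difference of the
  two sides of the abstract Green identity.\<close>

lemma krein_adj_eq_orth: "krein_adj J T = krein_orth (J_hat J) T"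
proof -
  have "cinner (f, f') (J_hat J (g, g')) = \<i> * (cinner f' (J g) - cinner f (J g'))" for f f' g g'
    by (simp add: J_hat_def cinner_prod_def cinner_scaleC_right algebra_simps)
  then show ?thesis
    by (force simp: krein_adj_def krein_orth_def krein_inner_def)
qed

section \<open>Isometric and unitary relations\<close>

text \<open>As \<open>j1\<close> is its own inverse, it moves from the adjoint onto
  \<open>x\<close>, and membership becomes equality of two indefinite pairings.\<close>

lemma rel_sharp_iff:
  assumes "fundamental_symmetry j1"
  shows "(x, y) \<in> rel_sharp j1 j2 R \<longleftrightarrow> (\<forall>(u, v)\<in>R. cinner u (j1 x) = cinner v (j2 y))"
proof -
  have "(x, y) \<in> rel_sharp j1 j2 R \<longleftrightarrow> (\<exists>x'. x = j1 x' \<and> (\<forall>(u, v)\<in>R. cinner v (j2 y) = cinner u x'))"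
    by (auto simp: rel_sharp_def rel_adj_def op_graph_def hilbert_adj_def relcomp_unfold)
  also have "\<dots> \<longleftrightarrow> (\<forall>(u, v)\<in>R. cinner v (j2 y) = cinner u (j1 x))"
    using fs_invol[OF assms] by metis
  finally show ?thesis
    by (simp add: eq_commute)
qed

text \<open>Under the difference of the two metrics, equality of pairings turns into orthogonality
  of pairs.\<close>

lemma fundamental_symmetry_difference:
  assumes "fundamental_symmetry j1" "fundamental_symmetry j2"
  shows "fundamental_symmetry (\<lambda>(x, y). (j1 x, - j2 y))"
  by (rule fundamental_symmetryI)
    (auto simp: split_beta fundamental_symmetryD[OF assms(1)] fundamental_symmetryD[OF assms(2)]
      fs_minus[OF assms(2)] scaleC_prod_def cinner_prod_def)

lemma rel_sharp_eq_orth: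
  assumes "fundamental_symmetry j1"
  shows "rel_sharp j1 j2 R = krein_orth (\<lambda>(x, y). (j1 x, - j2 y)) R"
  by (auto simp: rel_sharp_iff[OF assms] krein_orth_def cinner_prod_def Ball_def)

lemma
  assumes "fundamental_symmetry j1" "fundamental_symmetry j2"
  shows closed_rel_sharp: "closed (rel_sharp j1 j2 R)"
    and rel_sharp_sharp: "linear_relation R \<Longrightarrow> rel_sharp j1 j2 (rel_sharp j1 j2 R) = closure R"
  by (simp_all add: assms rel_sharp_eq_orth krein_orth_subspace closed_krein_orth
      krein_orth_orth_eq_closure fundamental_symmetry_difference)

lemma rel_ker_sharp:
  assumes "fundamental_symmetry j1" "fundamental_symmetry j2"
  shows "rel_ker (rel_sharp j1 j2 R) = krein_orth j1 (Domain R)"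
  by (auto simp: rel_ker_def rel_sharp_iff assms fs_zero krein_orth_def)

lemma rel_sharp_converse:
  assumes "fundamental_symmetry j1" "fundamental_symmetry j2"
  shows "rel_sharp j2 j1 (R\<inverse>) = (rel_sharp j1 j2 R)\<inverse>"
  by (auto simp: rel_sharp_iff assms Ball_def)

section \<open>Algebra of linear relations\<close>

lemma linear_relation_iff:
  "linear_relation R \<longleftrightarrow> (0, 0) \<in> R
    \<and> (\<forall>x y x' y'. (x, y) \<in> R \<longrightarrow> (x', y') \<in> R \<longrightarrow> (x + x', y + y') \<in> R)
    \<and> (\<forall>c x y. (x, y) \<in> R \<longrightarrow> (c *\<^sub>C x, c *\<^sub>C y) \<in> R)"
  unfolding complex_vector.subspace_def Ball_def split_paired_All
  by (auto simp: zero_prod_def scaleC_prod_def)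

lemma
  assumes "linear_relation R"
  shows linear_relation_zero: "(0, 0) \<in> R"
    and linear_relation_add: "(x, y) \<in> R \<Longrightarrow> (x', y') \<in> R \<Longrightarrow> (x + x', y + y') \<in> R"
    and linear_relation_scale: "(x, y) \<in> R \<Longrightarrow> (c *\<^sub>C x, c *\<^sub>C y) \<in> R"
  using assms by (simp_all add: linear_relation_iff)

lemma linear_relation_converse: "linear_relation R \<Longrightarrow> linear_relation (R\<inverse>)"
  by (simp add: linear_relation_iff)

lemma linear_relation_relcomp:
  assumes "linear_relation R" "linear_relation Q"
  shows "linear_relation (R O Q)"
  unfolding linear_relation_iff
  by (blast intro: assms[THEN linear_relation_zero] assms[THEN linear_relation_add]
      assms[THEN linear_relation_scale])

lemma linear_relation_diff:
  assumes "linear_relation R" "(x, y) \<in> R" "(x', y') \<in> R"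
  shows "(x - x', y - y') \<in> R"
  using complex_vector.subspace_diff[OF assms] by simp

lemma csubspace_Domain:
  assumes "linear_relation R"
  shows "complex_vector.subspace (Domain R)"
  unfolding complex_vector.subspace_def
  by (blast intro: assms[THEN linear_relation_zero] assms[THEN linear_relation_add]
      assms[THEN linear_relation_scale])

lemma csubspace_Image:
  assumes "linear_relation R" "complex_vector.subspace S"
  shows "complex_vector.subspace (R `` S)"
  unfolding complex_vector.subspace_def
  by (blast intro: linear_relation_zero[OF assms(1)] linear_relation_add[OF assms(1)]
      linear_relation_scale[OF assms(1)] complex_vector.subspace_0[OF assms(2)]
      complex_vector.subspace_add[OF assms(2)] complex_vector.subspace_scale[OF assms(2)])

section \<open>Unitary relations with closed domain\<close>

locale unitary_closed_domain =
  fixes j1 :: "'a::chilbert_space \<Rightarrow> 'a" and j2 :: "'b::chilbert_space \<Rightarrow> 'b"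
    and V :: "('a \<times> 'b) set"
  assumes j1: "fundamental_symmetry j1" and j2: "fundamental_symmetry j2"
    and unitary: "unitary_relation j1 j2 V" and closed_Domain: "closed (Domain V)"
begin

lemma linear: "linear_relation V"
  using unitary by (simp add: unitary_relation_def)

lemma V_iff: "(x, y) \<in> V \<longleftrightarrow> (\<forall>(u, v)\<in>V. cinner u (j1 x) = cinner v (j2 y))"
  using unitary rel_sharp_iff[OF j1] by (metis unitary_relation_def)

lemma preserves: "(x, y) \<in> V \<Longrightarrow> (u, v) \<in> V \<Longrightarrow> cinner u (j1 x) = cinner v (j2 y)"
  using V_iff by blast

lemma closed_V: "closed V"
  using unitary closed_rel_sharp[OF j1 j2] by (metis unitary_relation_def)

lemma rel_ker_eq: "rel_ker V = krein_orth j1 (Domain V)"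
  using unitary rel_ker_sharp[OF j1 j2] by (metis unitary_relation_def)

text \<open>The double complement of the domain is its closure; this is where closedness of the
  domain enters.\<close>

lemma orth_rel_ker: "krein_orth j1 (rel_ker V) = Domain V"
  by (simp add: rel_ker_eq krein_orth_orth_eq_closure[OF j1] csubspace_Domain linear closed_Domain)

lemma unitary_converse: "unitary_relation j2 j1 (V\<inverse>)"
  using unitary linear by (metis linear_relation_converse rel_sharp_converse[OF j1 j2]
      unitary_relation_def)

text \<open>The vectors \<open>x\<close> with \<open>j1 x \<in> dom V\<close> are those orthogonal to \<open>ker V\<close> in the Hilbert space
  sense.  For \<open>(x, y) \<in> V\<close> with \<open>\<parallel>y\<parallel> \<le> 1\<close> and \<open>(u, v) \<in> V\<close> the pairing of \<open>u\<close> with \<open>j1 x\<close> is at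
  most \<open>\<parallel>v\<parallel>\<close>, so that uniform boundedness on \<open>dom V\<close> applies.\<close>

lemma bounded_below:
  "\<exists>c. \<forall>(x, y)\<in>V. j1 x \<in> Domain V \<longrightarrow> norm x \<le> c * norm y"
proof -
  \<comment> \<open>Using \<open>j1 x\<close> in place of \<open>x\<close> puts \<open>B\<close>
    inside the closed subspace \<open>Domain V\<close> without changing norms.\<close>
  define B where "B = {j1 x |x y. (x, y) \<in> V \<and> j1 x \<in> Domain V \<and> norm y \<le> 1}"
  have "bounded B"
  proof (rule pointwise_bounded_imp_bounded)
    show "subspace (Domain V)"
      by (simp add: csubspace_Domain csubspace_imp_subspace linear)
    show "\<exists>K. \<forall>w\<in>B. \<bar>inner u w\<bar> \<le> K" if "u \<in> Domain V" for u
    proof -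
      from that obtain v where v: "(u, v) \<in> V" by auto
      have "\<bar>inner u (j1 x)\<bar> \<le> norm v" if "(x, y) \<in> V" "norm y \<le> 1" for x y
      proof -
        have "inner u (j1 x) = inner v (j2 y)"
          using preserves[OF that(1) v] by (simp flip: Re_cinner)
        also have "\<bar>\<dots>\<bar> \<le> norm v * norm (j2 y)"
          by (rule Cauchy_Schwarz_ineq2)
        also have "\<dots> \<le> norm v * 1"
          using that(2) by (intro mult_left_mono) (simp_all add: fs_norm[OF j2])
        finally show ?thesis by simp
      qed
      then show ?thesis
        unfolding B_def by blast
    qed
  qed (auto simp: B_def closed_Domain)
  then obtain c where c: "\<And>w. w \<in> B \<Longrightarrow> norm w \<le> c"
    by (auto simp: bounded_iff)
  have "norm x \<le> c * norm y" if xy: "(x, y) \<in> V" and jx: "j1 x \<in> Domain V" for x y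
  proof -
    have scaled: "norm (a *\<^sub>R x) \<le> c" if "norm (a *\<^sub>R y) \<le> 1" for a
    proof -
      have "(a *\<^sub>R x, a *\<^sub>R y) \<in> V"
        using csubspace_imp_subspace[OF linear] xy by (auto dest: subspace_scale[of _ _ a])
      moreover have "j1 (a *\<^sub>R x) = a *\<^sub>R j1 x"
        using fs_scaleC[OF j1, of "complex_of_real a" x] by (simp only: scaleC_of_real)
      moreover have "a *\<^sub>R j1 x \<in> Domain V"
        using subspace_scale[OF csubspace_imp_subspace[OF csubspace_Domain[OF linear]] jx] .
      ultimately have "j1 (a *\<^sub>R x) \<in> B"
        using that unfolding B_def by force
      from c[OF this] show ?thesis
        by (simp only: fs_norm[OF j1])
    qed
    show ?thesis
    proof (cases "y = 0")
      case True
      have "x = 0"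
      proof (rule ccontr)
        assume "x \<noteq> 0"
        then have "norm (((\<bar>c\<bar> + 1) / norm x) *\<^sub>R x) = \<bar>c\<bar> + 1" by simp
        with scaled[of "(\<bar>c\<bar> + 1) / norm x"] True show False by simp
      qed
      with True show ?thesis by simp
    next
      case False
      then have "norm x / norm y \<le> c"
        using scaled[of "1 / norm y"] by simp
      with False show ?thesis by (simp add: field_simps)
    qed
  qed
  then show ?thesis by blast
qed

text \<open>Preimages normalised modulo \<open>rel_ker V\<close> are controlled by
  \<open>bounded_below\<close>. A convergent sequence in the range thus has Cauchy preimages, and
  \<open>V\<close> is closed.\<close>

lemma closed_Range: "closed (Range V)"
proof -
  obtain c where c: "\<And>x y. (x, y) \<in> V \<Longrightarrow> j1 x \<in> Domain V \<Longrightarrow> norm x \<le> c * norm y"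
    using bounded_below by blast
  have D: "complex_vector.subspace (Domain V)"
    by (simp add: csubspace_Domain linear)
  \<comment> \<open>Removing the projection of \<open>x\<close> to the kernel keeps
    \<open>y\<close>, and \<open>j1\<close> of the rest is orthogonal to \<open>rel_ker V\<close> in
    the indefinite metric, hence in \<open>Domain V\<close>.\<close>
  have lift: "\<exists>x. (x, y) \<in> V \<and> j1 x \<in> Domain V" if "y \<in> Range V" for y
  proof -
    from that obtain x where x: "(x, y) \<in> V" by auto
    have K: "complex_vector.subspace (rel_ker V)" and cK: "closed (rel_ker V)"
      by (simp_all add: rel_ker_eq krein_orth_subspace[OF j1] closed_krein_orth[OF j1])
    obtain p where p: "p \<in> rel_ker V" "\<And>s. s \<in> rel_ker V \<Longrightarrow> inner s (x - p) = 0"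
      using orthogonal_projection_exists[OF csubspace_imp_subspace[OF K] cK] by blast
    have "j1 (x - p) \<in> krein_orth j1 (rel_ker V)"
      using cinner_eq_0_if_inner_eq_0[OF K p(2)] by (simp add: krein_orth_def fs_invol[OF j1])
    moreover have "(x - p, y) \<in> V"
      using linear_relation_diff[OF linear x, of p 0] p(1) by (simp add: rel_ker_def)
    ultimately show ?thesis
      using orth_rel_ker by blast
  qed
  show ?thesis
  proof (unfold closed_sequential_limits, intro allI impI, elim conjE)
    fix y l assume yR: "\<forall>n. y n \<in> Range V" and yl: "y \<longlonglongrightarrow> l"
    have "\<exists>x. (x, y n) \<in> V \<and> j1 x \<in> Domain V" for n
      using lift yR by blast
    then obtain x where x: "\<And>n. (x n, y n) \<in> V" "\<And>n. j1 (x n) \<in> Domain V"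
      by metis
    have le: "norm (x m - x n) \<le> c * norm (y m - y n)" for m n
      using linear_relation_diff[OF linear x(1) x(1)] complex_vector.subspace_diff[OF D x(2) x(2)]
      by (intro c) (simp_all add: fs_diff[OF j1])
    have "Cauchy x"
    proof (rule metric_CauchyI)
      fix e :: real assume "e > 0"
      \<comment> \<open>\<open>bounded_below\<close> gives no sign for \<open>c\<close>;
        \<open>\<bar>c\<bar> + 1\<close> is a positive substitute.\<close>
      then have "e / (\<bar>c\<bar> + 1) > 0" by (simp add: add_nonneg_pos)
      then obtain N where N: "\<And>m n. m \<ge> N \<Longrightarrow> n \<ge> N \<Longrightarrow> norm (y m - y n) < e / (\<bar>c\<bar> + 1)"
        using LIMSEQ_imp_Cauchy[OF yl] unfolding Cauchy_def dist_norm by meson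
      have "norm (x m - x n) < e" if "m \<ge> N" "n \<ge> N" for m n
      proof -
        have "norm (x m - x n) \<le> (\<bar>c\<bar> + 1) * norm (y m - y n)"
          by (rule order_trans[OF le mult_right_mono]) simp_all
        also have "\<dots> < e"
          using N[OF that] by (simp add: pos_less_divide_eq mult.commute add_nonneg_pos)
        finally show ?thesis .
      qed
      then show "\<exists>N. \<forall>m\<ge>N. \<forall>n\<ge>N. dist (x m) (x n) < e"
        unfolding dist_norm by blast
    qed
    then obtain k where "x \<longlonglongrightarrow> k"
      using Cauchy_convergent convergent_def by blast
    then have "(\<lambda>n. (x n, y n)) \<longlonglongrightarrow> (k, l)"
      using yl by (rule tendsto_Pair)
    with x(1) have "(k, l) \<in> V"
      by (rule closed_sequentially[OF closed_V])
    then show "l \<in> Range V" by blast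
  qed
qed

text \<open>The hypotheses are now symmetric in \<open>V\<close> and its converse, so facts on
  kernel and domain yield facts on multivalued part and range.\<close>

lemma converse: "unitary_closed_domain j2 j1 (V\<inverse>)"
  by unfold_locales (simp_all add: j1 j2 unitary_converse closed_Range)

lemma orth_rel_mul: "krein_orth j2 (rel_mul V) = Range V"
  using unitary_closed_domain.orth_rel_ker[OF converse] by (simp add: rel_ker_def rel_mul_def)

text \<open>As \<open>0 \<in> S\<close>, the image contains \<open>rel_mul V\<close>. A vector
  orthogonal to the image therefore lies in \<open>Range V\<close>, and its lift inherits
  orthogonality since \<open>V\<close> preserves pairings.\<close>

lemma orth_Image:
  assumes S: "S \<subseteq> Domain V" "0 \<in> S"
  shows "krein_orth j2 (V `` S) = V `` krein_orth j1 S"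
proof
  show "V `` krein_orth j1 S \<subseteq> krein_orth j2 (V `` S)"
    using preserves by (fastforce simp: krein_orth_def)
  show "krein_orth j2 (V `` S) \<subseteq> V `` krein_orth j1 S"
  proof
    fix y assume y: "y \<in> krein_orth j2 (V `` S)"
    have "rel_mul V \<subseteq> V `` S"
      using S(2) by (auto simp: rel_mul_def)
    then have "y \<in> Range V"
      using y orth_rel_mul krein_orth_antimono by blast
    then obtain x where x: "(x, y) \<in> V" by auto
    have "cinner s (j1 x) = 0" if "s \<in> S" for s
    proof -
      obtain t where t: "(s, t) \<in> V"
        using \<open>s \<in> S\<close> S(1) by auto
      with y that have "cinner t (j2 y) = 0"
        by (auto simp: krein_orth_def)
      then show ?thesis
        using preserves[OF x t] by simp
    qed
    with x show "y \<in> V `` krein_orth j1 S"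
      by (auto simp: krein_orth_def)
  qed
qed

lemma rel_sharp_comp:
  assumes R: "Domain R \<subseteq> Domain V" "(0, 0) \<in> R"
  shows "rel_sharp j2 j3 (V\<inverse> O R) = V\<inverse> O rel_sharp j1 j3 R"
proof
  show "V\<inverse> O rel_sharp j1 j3 R \<subseteq> rel_sharp j2 j3 (V\<inverse> O R)"
  proof clarify
    fix y x l assume yx: "(x, y) \<in> V" and xl: "(x, l) \<in> rel_sharp j1 j3 R"
    show "(y, l) \<in> rel_sharp j2 j3 (V\<inverse> O R)"
      unfolding rel_sharp_iff[OF j2]
    proof clarify
      fix v u l' assume uv: "(u, v) \<in> V" and ul: "(u, l') \<in> R"
      show "cinner v (j2 y) = cinner l' (j3 l)"
        using preserves[OF yx uv] xl ul by (auto simp: rel_sharp_iff[OF j1])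
    qed
  qed
  show "rel_sharp j2 j3 (V\<inverse> O R) \<subseteq> V\<inverse> O rel_sharp j1 j3 R"
  proof (rule subrelI)
    fix y l assume "(y, l) \<in> rel_sharp j2 j3 (V\<inverse> O R)"
    then have yl: "cinner y' (j2 y) = cinner l' (j3 l)" if "(x, y') \<in> V" "(x, l') \<in> R" for x y' l'
      using that by (fastforce simp: rel_sharp_iff j2)
    \<comment> \<open>Since \<open>(0, 0) \<in> R\<close>, the composition contains
      \<open>(y', 0)\<close> for every \<open>y'\<close> in \<open>rel_mul V\<close>.\<close>
    have "y \<in> krein_orth j2 (rel_mul V)"
      using yl[OF _ R(2)] by (simp add: krein_orth_def rel_mul_def)
    then obtain x where x: "(x, y) \<in> V"
      using orth_rel_mul by auto
    have "(x, l) \<in> rel_sharp j1 j3 R"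
      unfolding rel_sharp_iff[OF j1]
    proof clarify
      fix u l' assume ul: "(u, l') \<in> R"
      then obtain v where v: "(u, v) \<in> V" using R(1) by auto
      show "cinner u (j1 x) = cinner l' (j3 l)"
        using preserves[OF x v] yl[OF v ul] by simp
    qed
    with x show "(y, l) \<in> V\<inverse> O rel_sharp j1 j3 R" by blast
  qed
qed

text \<open>Two elements with a common image under \<open>V\<close> differ by an element of
  \<open>rel_ker V\<close>, which \<open>R\<close> sends to 0.\<close>

lemma comp_comp_cancel:
  assumes "linear_relation R" "Domain R \<subseteq> Domain V" "rel_ker V \<subseteq> rel_ker R"
  shows "V O (V\<inverse> O R) = R"
proof
  show "V O (V\<inverse> O R) \<subseteq> R"
  proof clarify
    fix x y x' l assume "(x, y) \<in> V" "(x', y) \<in> V" and l: "(x', l) \<in> R"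
    then have "x - x' \<in> rel_ker V"
      using linear_relation_diff[OF linear] by (fastforce simp: rel_ker_def)
    then have "(x - x', 0) \<in> R"
      using assms(3) by (auto simp: rel_ker_def)
    from linear_relation_add[OF assms(1) this l] show "(x, l) \<in> R"
      by simp
  qed
  show "R \<subseteq> V O (V\<inverse> O R)"
  proof (rule subrelI)
    fix x l assume "(x, l) \<in> R"
    moreover from this obtain y where "(x, y) \<in> V"
      using assms(2) by auto
    ultimately show "(x, l) \<in> V O (V\<inverse> O R)" by blast
  qed
qed

lemma Image_converse_Image:
  assumes "complex_vector.subspace T" "T \<subseteq> Domain V" "rel_ker V \<subseteq> T"
  shows "V\<inverse> `` V `` T = T"
proof
  show "V\<inverse> `` V `` T \<subseteq> T"
  proof clarify
    fix x y x' assume "(x, y) \<in> V" "(x', y) \<in> V" and x': "x' \<in> T"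
    then have "x - x' \<in> T"
      using linear_relation_diff[OF linear] assms(3) by (fastforce simp: rel_ker_def)
    from complex_vector.subspace_add[OF assms(1) this x'] show "x \<in> T"
      by simp
  qed
  show "T \<subseteq> V\<inverse> `` V `` T"
    using assms(2) by blast
qed

section \<open>Transfer of isometric, unitary and essentially unitary relations\<close>

context
  fixes j3 :: "'c::chilbert_space \<Rightarrow> 'c"
  assumes j3: "fundamental_symmetry j3"
begin

lemma isometric_relation_comp:
  assumes "isometric_relation j1 j3 R" "Domain R \<subseteq> Domain V"
  shows "isometric_relation j2 j3 (V\<inverse> O R)"
proof -
  have R: "linear_relation R" "R \<subseteq> rel_sharp j1 j3 R"
    using assms(1) by (simp_all add: isometric_relation_def)
  have "(0, 0) \<in> R"
    using linear_relation_zero[OF R(1)] .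
  with R assms(2) show ?thesis
    unfolding isometric_relation_def
    by (auto simp: rel_sharp_comp linear_relation_relcomp linear_relation_converse linear)
qed

lemma unitary_relation_comp:
  assumes "unitary_relation j1 j3 R" "Domain R \<subseteq> Domain V"
  shows "unitary_relation j2 j3 (V\<inverse> O R)"
proof -
  have R: "linear_relation R" "rel_sharp j1 j3 R = R"
    using assms(1) by (simp_all add: unitary_relation_def)
  have "(0, 0) \<in> R"
    using linear_relation_zero[OF R(1)] .
  with R assms(2) show ?thesis
    unfolding unitary_relation_def
    by (auto simp: rel_sharp_comp linear_relation_relcomp linear_relation_converse linear)
qed

text \<open>The closure of the composition is computed as its double \<open>rel_sharp\<close>:
  \<open>rel_sharp_comp\<close> is applied first to \<open>R\<close>, then to
  \<open>closure R\<close>, whose domain stays in the closed set \<open>Domain V\<close>.\<close>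

lemma ess_unitary_relation_comp:
  assumes "ess_unitary_relation j1 j3 R" "Domain R \<subseteq> Domain V"
  shows "ess_unitary_relation j2 j3 (V\<inverse> O R)"
proof -
  have R: "linear_relation R" "rel_sharp j1 j3 R = closure R"
    using assms(1) by (simp_all add: ess_unitary_relation_def)
  have R0: "(0, 0) \<in> R"
    using linear_relation_zero[OF R(1)] .
  have dom: "Domain (closure R) \<subseteq> Domain V"
  proof
    fix x assume "x \<in> Domain (closure R)"
    then obtain y where "(x, y) \<in> closure R" by auto
    moreover have "closure R \<subseteq> Domain V \<times> UNIV"
      using assms(2) by (intro closure_minimal closed_Times closed_Domain) auto
    ultimately show "x \<in> Domain V" by auto
  qed
  have lin: "linear_relation (V\<inverse> O R)"
    by (simp add: linear_relation_relcomp linear_relation_converse linear R)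
  have sharp: "rel_sharp j2 j3 (V\<inverse> O R) = V\<inverse> O closure R"
    by (simp add: rel_sharp_comp assms(2) R0 R)
  have "closure (V\<inverse> O R) = rel_sharp j2 j3 (rel_sharp j2 j3 (V\<inverse> O R))"
    by (simp add: rel_sharp_sharp[OF j2 j3] lin)
  also have "\<dots> = V\<inverse> O rel_sharp j1 j3 (closure R)"
    using R0 closure_subset by (subst sharp, intro rel_sharp_comp dom) blast
  also have "rel_sharp j1 j3 (closure R) = closure R"
    using rel_sharp_sharp[OF j1 j3 R(1)] by (simp add: R(2))
  finally show ?thesis
    by (simp add: ess_unitary_relation_def lin sharp)
qed

end

end

section \<open>Boundary pairs\<close>

text \<open>\<open>T\<close> is the complement of \<open>Domain G\<close>, so its adjoint is the
  closure of \<open>Domain G\<close>.\<close>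

lemma isometric_bpD:
  assumes "fundamental_symmetry J" "isometric_bp J T G"
  shows "isometric_relation (J_hat J) (J_hat id) G" and "linear_relation G"
    and "T = krein_orth (J_hat J) (Domain G)" and "Domain G \<subseteq> krein_adj J T"
proof -
  have J: "fundamental_symmetry (J_hat J)"
    by (simp add: assms(1) fundamental_symmetry_J_hat)
  show "isometric_relation (J_hat J) (J_hat id) G"
    using assms(2) by (simp add: isometric_bp_def)
  then show lin: "linear_relation G"
    by (simp add: isometric_relation_def)
  show T: "T = krein_orth (J_hat J) (Domain G)"
    using assms by (simp add: isometric_bp_def rel_ker_sharp J fundamental_symmetry_J_hat
        fundamental_symmetry_id)
  show "Domain G \<subseteq> krein_adj J T"
    unfolding krein_adj_eq_orth T krein_orth_orth_eq_closure[OF J csubspace_Domain[OF lin]]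
    by (rule closure_subset)
qed

text \<open>\<open>ker V \<subseteq> T\<close> is \<open>T\<^sup>+ \<subseteq> dom V\<close>, which holds as soon as one boundary pair for \<open>T\<^sup>+\<close> has its
  domain in \<open>dom V\<close>, and then forces this for every boundary pair for \<open>T\<^sup>+\<close>.\<close>

locale boundary_transform =
  fixes J :: "'h::chilbert_space \<Rightarrow> 'h" and J' :: "'k::chilbert_space \<Rightarrow> 'k"
    and T :: "('h \<times> 'h) set" and V :: "(('h \<times> 'h) \<times> ('k \<times> 'k)) set"
  assumes J: "fundamental_symmetry J" and J': "fundamental_symmetry J'"
    and closed_T: "closed T" and symmetric_T: "symmetric_relation J T"
    and V: "unitary_relation (J_hat J) (J_hat J') V" "closed (Domain V)"
    and ker_V: "rel_ker V \<subseteq> T"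
begin

sublocale unitary_closed_domain "J_hat J" "J_hat J'" V
  by unfold_locales (simp_all add: fundamental_symmetry_J_hat J J' V)

lemma subspace_T: "linear_relation T" and T_subset_adj: "T \<subseteq> krein_adj J T"
  using symmetric_T by (simp_all add: symmetric_relation_def)

lemma adj_subset_Domain: "krein_adj J T \<subseteq> Domain V"
  using krein_orth_antimono[OF ker_V, of "J_hat J"] orth_rel_ker by (simp add: krein_adj_eq_orth)

lemma T_subset_Domain: "T \<subseteq> Domain V"
  using T_subset_adj adj_subset_Domain by blast

lemma adj_Image: "krein_adj J' (V `` T) = V `` krein_adj J T"
  unfolding krein_adj_eq_orth
  by (rule orth_Image[OF T_subset_Domain]) (rule complex_vector.subspace_0[OF subspace_T])

text \<open>By \<open>orth_Image\<close> the image of \<open>T\<close> is the complement of the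
  image of the adjoint, because \<open>T\<close> is its own double complement.\<close>

lemma closed_Image: "closed (V `` T)"
proof -
  have "krein_orth (J_hat J') (V `` krein_adj J T) = V `` krein_orth (J_hat J) (krein_adj J T)"
    by (intro orth_Image adj_subset_Domain)
      (simp add: krein_adj_eq_orth complex_vector.subspace_0 krein_orth_subspace j1)
  also have "krein_orth (J_hat J) (krein_adj J T) = T"
    by (simp add: krein_adj_eq_orth krein_orth_orth_eq_closure j1 subspace_T closed_T)
  finally show ?thesis
    using closed_krein_orth[OF j2] by metis
qed

lemma symmetric_Image: "symmetric_relation J' (V `` T)"
  unfolding symmetric_relation_def adj_Image
  using T_subset_adj by (auto simp: csubspace_Image linear subspace_T)

lemma mul_V: "rel_mul V \<subseteq> V `` T"
  using complex_vector.subspace_0[OF subspace_T] by (auto simp: rel_mul_def)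

text \<open>\<open>mul_V\<close> is the assumption \<open>ker_V\<close> for the converse, so every
  transfer also runs backwards.\<close>

lemma boundary_transform_converse: "boundary_transform J' J (V `` T) (V\<inverse>)"
  by unfold_locales
    (use mul_V in \<open>simp_all add: J J' closed_Image symmetric_Image unitary_converse closed_Range
      rel_ker_def rel_mul_def\<close>)

section \<open>Transfer of boundary pairs\<close>

lemma bp_Domain: "isometric_bp J T G \<Longrightarrow> Domain G \<subseteq> Domain V"
  using isometric_bpD(4)[OF J] adj_subset_Domain by blast

text \<open>\<open>orth_Image\<close> carries the identity of \<open>T\<close> with the complement
  of \<open>Domain G\<close> over to the image of \<open>Domain G\<close>, the domain of the
  composition.\<close>

lemma isometric_bp_comp:
  assumes "isometric_bp J T G"
  shows "isometric_bp J' (V `` T) (V\<inverse> O G)"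
proof -
  note G = isometric_bpD[OF J assms]
  have "V `` T = krein_orth (J_hat J') (V `` Domain G)"
    using G(3) orth_Image[OF bp_Domain[OF assms] complex_vector.subspace_0[OF csubspace_Domain[OF G(2)]]]
    by simp
  also have "V `` Domain G = Domain (V\<inverse> O G)"
    by blast
  finally show ?thesis
    using isometric_relation_comp[OF fundamental_symmetry_J_hat[OF fundamental_symmetry_id] G(1)
        bp_Domain[OF assms]]
    by (simp add: isometric_bp_def rel_ker_sharp[OF j2] fundamental_symmetry_J_hat
        fundamental_symmetry_id)
qed

lemma ess_unitary_bp_comp:
  assumes "ess_unitary_bp J T G"
  shows "ess_unitary_bp J' (V `` T) (V\<inverse> O G)"
  using assms bp_Domain[of G] isometric_bp_comp[of G]
    ess_unitary_relation_comp[OF fundamental_symmetry_J_hat[OF fundamental_symmetry_id], of G]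
  by (simp add: ess_unitary_bp_def)

lemma unitary_bp_comp:
  assumes "unitary_bp J T G"
  shows "unitary_bp J' (V `` T) (V\<inverse> O G)"
  using assms bp_Domain[of G] isometric_bp_comp[of G]
    unitary_relation_comp[OF fundamental_symmetry_J_hat[OF fundamental_symmetry_id], of G]
  by (simp add: unitary_bp_def)

lemma bp_comp_cancel:
  "isometric_bp J T G \<Longrightarrow> rel_ker V \<subseteq> rel_ker G \<Longrightarrow> V O (V\<inverse> O G) = G"
  by (simp add: comp_comp_cancel isometric_bpD(2)[OF J] bp_Domain)

lemma rel_mul_subset_ker_comp:
  "isometric_bp J T G \<Longrightarrow> rel_mul V \<subseteq> rel_ker (V\<inverse> O G)"
  using linear_relation_zero[OF isometric_bpD(2)[OF J]]
  by (fastforce simp: rel_mul_def rel_ker_def)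

section \<open>The 1-1 correspondence\<close>

interpretation conv: boundary_transform J' J "V `` T" "V\<inverse>"
  by (rule boundary_transform_converse)

text \<open>A common frame for the three classes of pairs. The kernel conditions make the two round
  trips identities, and each is automatic for relations obtained by transfer from the other
  side.\<close>

lemma bij_betw_comp:
  assumes iso: "\<And>G. P G \<Longrightarrow> isometric_bp J T G" "\<And>G'. P' G' \<Longrightarrow> isometric_bp J' (V `` T) G'"
    and transfer: "\<And>G. P G \<Longrightarrow> P' (V\<inverse> O G)" "\<And>G'. P' G' \<Longrightarrow> P (V O G')"
  shows "bij_betw (\<lambda>G. V\<inverse> O G) {G. P G \<and> rel_ker V \<subseteq> rel_ker G}
    {G'. P' G' \<and> rel_mul V \<subseteq> rel_ker G'}"
proof (rule bij_betw_byWitness[where f' = "\<lambda>G'. V O G'"])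
  have ker: "rel_ker (V\<inverse>) = rel_mul V" "rel_mul (V\<inverse>) = rel_ker V"
    by (simp_all add: rel_ker_def rel_mul_def)
  show "\<forall>G\<in>{G. P G \<and> rel_ker V \<subseteq> rel_ker G}. V O (V\<inverse> O G) = G"
    using iso(1) bp_comp_cancel by blast
  show "\<forall>G'\<in>{G'. P' G' \<and> rel_mul V \<subseteq> rel_ker G'}. V\<inverse> O (V O G') = G'"
  proof (intro ballI)
    fix G' assume "G' \<in> {G'. P' G' \<and> rel_mul V \<subseteq> rel_ker G'}"
    then show "V\<inverse> O (V O G') = G'"
      using iso(2)[of G'] conv.bp_comp_cancel[of G'] by (simp add: ker)
  qed
  show "(\<lambda>G. V\<inverse> O G) ` {G. P G \<and> rel_ker V \<subseteq> rel_ker G} \<subseteq> {G'. P' G' \<and> rel_mul V \<subseteq> rel_ker G'}"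
    using iso(1) transfer(1) rel_mul_subset_ker_comp by blast
  show "(\<lambda>G'. V O G') ` {G'. P' G' \<and> rel_mul V \<subseteq> rel_ker G'} \<subseteq> {G. P G \<and> rel_ker V \<subseteq> rel_ker G}"
    using iso(2) transfer(2) conv.rel_mul_subset_ker_comp by (auto simp: ker)
qed

lemma Image_back: "V\<inverse> `` V `` T = T"
  by (rule Image_converse_Image[OF subspace_T T_subset_Domain ker_V])

lemma bij_betw_isometric_bp:
  "bij_betw (\<lambda>G. V\<inverse> O G) {G. isometric_bp J T G \<and> rel_ker V \<subseteq> rel_ker G}
    {G'. isometric_bp J' (V `` T) G' \<and> rel_mul V \<subseteq> rel_ker G'}"
  using conv.isometric_bp_comp by (intro bij_betw_comp) (simp_all add: isometric_bp_comp Image_back)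

lemma bij_betw_ess_unitary_bp:
  "bij_betw (\<lambda>G. V\<inverse> O G) {G. ess_unitary_bp J T G \<and> rel_ker V \<subseteq> rel_ker G}
    {G'. ess_unitary_bp J' (V `` T) G' \<and> rel_mul V \<subseteq> rel_ker G'}"
  using conv.ess_unitary_bp_comp
  by (intro bij_betw_comp) (simp_all add: ess_unitary_bp_comp Image_back, simp_all add: ess_unitary_bp_def)

text \<open>For a unitary pair \<open>G'\<close> equals its \<open>rel_sharp\<close>, so its kernel
  is the image of \<open>T\<close>, which contains \<open>rel_mul V\<close>.\<close>

lemma rel_mul_subset_ker_unitary_bp: "unitary_bp J' (V `` T) G' \<Longrightarrow> rel_mul V \<subseteq> rel_ker G'"
  using mul_V unfolding unitary_bp_def isometric_bp_def unitary_relation_def by metis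

lemma bij_betw_unitary_bp:
  "bij_betw (\<lambda>G. V\<inverse> O G)
    {G :: (('h \<times> 'h) \<times> ('l::chilbert_space \<times> 'l)) set. unitary_bp J T G \<and> rel_ker V \<subseteq> rel_ker G}
    {G'. unitary_bp J' (V `` T) G'}"
proof -
  have "bij_betw (\<lambda>G. V\<inverse> O G)
      {G :: (('h \<times> 'h) \<times> ('l \<times> 'l)) set. unitary_bp J T G \<and> rel_ker V \<subseteq> rel_ker G}
      {G'. unitary_bp J' (V `` T) G' \<and> rel_mul V \<subseteq> rel_ker G'}"
    using conv.unitary_bp_comp
    by (intro bij_betw_comp) (simp_all add: unitary_bp_comp Image_back, simp_all add: unitary_bp_def)
  moreover have "{G' :: (('k \<times> 'k) \<times> ('l \<times> 'l)) set. unitary_bp J' (V `` T) G' \<and> rel_mul V \<subseteq> rel_ker G'}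
      = {G'. unitary_bp J' (V `` T) G'}"
    using rel_mul_subset_ker_unitary_bp by blast
  ultimately show ?thesis by simp
qed

end

theorem theorem6p1:
  fixes J :: "'h::chilbert_space \<Rightarrow> 'h"
    and J' :: "'k::chilbert_space \<Rightarrow> 'k"
    and T :: "('h \<times> 'h) set"
    and \<Gamma> :: "(('h \<times> 'h) \<times> ('l::chilbert_space \<times> 'l)) set"
    and V :: "(('h \<times> 'h) \<times> ('k \<times> 'k)) set"
  assumes "fundamental_symmetry J"
    and "fundamental_symmetry J'"
    and "closed T" and "symmetric_relation J T"
    and "isometric_bp J T \<Gamma>"
    and "unitary_relation (J_hat J) (J_hat J') V"
    and "closed (Domain V)" and "Domain \<Gamma> \<subseteq> Domain V"
  shows "closed (V `` T) \<and> symmetric_relation J' (V `` T)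
    \<and> krein_adj J' (V `` T) = V `` krein_adj J T
    \<and> isometric_bp J' (V `` T) (V\<inverse> O \<Gamma>)
    \<and> (ess_unitary_bp J T \<Gamma> \<longrightarrow> ess_unitary_bp J' (V `` T) (V\<inverse> O \<Gamma>))
    \<and> (unitary_bp J T \<Gamma> \<longrightarrow> unitary_bp J' (V `` T) (V\<inverse> O \<Gamma>))
    \<and> (\<forall>z. z \<notin> \<real> \<longrightarrow> weyl_family (V\<inverse> O \<Gamma>) z = \<Gamma> `` N_hat V z (Domain \<Gamma>))
    \<and> (rel_ker V \<subseteq> rel_ker \<Gamma> \<longrightarrow> V O (V\<inverse> O \<Gamma>) = \<Gamma>)
    \<and> bij_betw (\<lambda>G. V\<inverse> O G)
        {G :: (('h \<times> 'h) \<times> ('l \<times> 'l)) set. isometric_bp J T G \<and> rel_ker V \<subseteq> rel_ker G}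
        {G'. isometric_bp J' (V `` T) G' \<and> rel_mul V \<subseteq> rel_ker G'}
    \<and> bij_betw (\<lambda>G. V\<inverse> O G)
        {G :: (('h \<times> 'h) \<times> ('l \<times> 'l)) set. ess_unitary_bp J T G \<and> rel_ker V \<subseteq> rel_ker G}
        {G'. ess_unitary_bp J' (V `` T) G' \<and> rel_mul V \<subseteq> rel_ker G'}
    \<and> bij_betw (\<lambda>G. V\<inverse> O G)
        {G :: (('h \<times> 'h) \<times> ('l \<times> 'l)) set. unitary_bp J T G \<and> rel_ker V \<subseteq> rel_ker G}
        {G'. unitary_bp J' (V `` T) G'}"
proof -
  \<comment> \<open>The locale assumption \<open>ker_V\<close> is obtained by taking complements in
    \<open>Domain \<Gamma> \<subseteq> Domain V\<close>.\<close>
  have "unitary_closed_domain (J_hat J) (J_hat J') V"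
    by unfold_locales (simp_all add: assms fundamental_symmetry_J_hat)
  then have "rel_ker V = krein_orth (J_hat J) (Domain V)"
    by (rule unitary_closed_domain.rel_ker_eq)
  also have "\<dots> \<subseteq> krein_orth (J_hat J) (Domain \<Gamma>)"
    by (rule krein_orth_antimono[OF assms(8)])
  also have "\<dots> = T"
    using isometric_bpD(3)[OF assms(1,5)] by simp
  finally interpret boundary_transform J J' T V
    by unfold_locales (simp_all add: assms)
  \<comment> \<open>Both sides ask for an element of \<open>Domain \<Gamma>\<close> that
    \<open>V\<close> relates to some \<open>(h, z *\<^sub>C h)\<close> and \<open>\<Gamma>\<close>
    relates to the given value.\<close>
  have "weyl_family (V\<inverse> O \<Gamma>) z = \<Gamma> `` N_hat V z (Domain \<Gamma>)" for z
    by (fastforce simp: weyl_family_def N_hat_def op_graph_def)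
  then show ?thesis
    by (intro conjI allI impI)
      (simp_all only: closed_Image symmetric_Image adj_Image isometric_bp_comp[OF assms(5)]
        ess_unitary_bp_comp unitary_bp_comp bp_comp_cancel[OF assms(5)]
        bij_betw_isometric_bp bij_betw_ess_unitary_bp bij_betw_unitary_bp)
qed

end
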